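(* Let $G$ be a social contribution bounded cost-minimization game, and suppose that the robust price of anarchy of the corresponding social contribution game $\bar G$ is $\xi$. Then for every $\alpha\in[0,1]^N$, the robust price of anarchy of the $\alpha$-altruistic extension $G^\alpha$ of $G$ is at most $\xi$.
   Context: A cost-minimization game $G=(N,\{\Sigma_i\}_{i\in N},\{C_i\}_{i\in N})$ has a finite player set $N$, strategy sets $\Sigma_i$, profiles $\Sigma=\prod_i\Sigma_i$, and cost functions $C_i:\Sigma\to\mathbb R$; it comes with a social cost $C:\Sigma\to\mathbb R$. $C$ is sum-bounded if $C(s)\le\sum_iC_i(s)$ for all $s$. $(t_i,s_{-i})$ denotes $s$ with player $i$'s strategy replaced by $t_i$. $G$ is social contribution bounded (SC-bounded) if its social cost is sum-bounded and for every player $i$ there is a default strategy $\emptyset_i$ such that $C_i(s)\le C(s)-C(\emptyset_i,s_{-i})$ for all $s\in\Sigma$. ($\emptyset_i$ need not belong to $\Sigma_i$; formally, one requires an extension of $C$ to a real-valued function on $\prod_{i\in N}(\Sigma_i\cup\{\emptyset_i\})$, again denoted $C$, satisfying these inequalities.) The corresponding social contribution game is $\bar G=(N,\{\Sigma_i\},\{\bar C_i\})$ with $\bar C_i(s)=C(s)-C(\emptyset_i,s_{-i})$ and the same social cost $C$. Altruistic extension: for $\alpha\in[0,1]^N$, $G^\alpha=(N,\{\Sigma_i\},\{C_i^\alpha\})$ with $C_i^\alpha=(1-\alpha_i)C_i+\alpha_iC$; its social cost is again $C$. Smoothness: write $C_{-i}:=C-C_i$. $G^\alpha$ is $(\lambda,\mu)$-smooth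 if there is an optimal profile $s^*$ (a minimizer of $C$ over $\Sigma$) such that for all $s\in\Sigma$, $$\sum_{i\in N}\big(C_i(s_i^*,s_{-i})+\alpha_i(C_{-i}(s_i^*,s_{-i})-C_{-i}(s))\big)\le\lambda C(s^* )+\mu C(s).$$ The robust price of anarchy of $G^\alpha$ is $\inf\{\frac{\lambda}{1-\mu} : G^\alpha\text{ is }(\lambda,\mu)\text{-smooth},\ \mu<1\}$. The robust price of anarchy of a game without altruism (such as $\bar G$) is the one obtained with $\alpha=\mathbf 0$ (for $\bar G$: with $C_i$ replaced by $\bar C_i$). *)

theory Defs
  imports Complex_Main "HOL-Library.Extended_Real" "HOL-Library.FuncSet"
begin

record ('p, 's) game =
  players :: "'p set"
  strategies :: "'p \<Rightarrow> 's set"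
  cost :: "'p \<Rightarrow> ('p \<Rightarrow> 's) \<Rightarrow> real"
  social_cost :: "('p \<Rightarrow> 's) \<Rightarrow> real"

text \<open>Costs are only meaningful on \<open>profiles G\<close>. All players draw their strategies from one
  type; this is no restriction, as \<open>'s\<close> may be a sum of the individual strategy types.\<close>

definition profiles :: "('p, 's) game \<Rightarrow> ('p \<Rightarrow> 's) set" where
  "profiles G = (\<Pi>\<^sub>E i\<in>players G. strategies G i)"

definition sum_bounded :: "('p, 's) game \<Rightarrow> bool" where
  "sum_bounded G \<longleftrightarrow> (\<forall>s\<in>profiles G. social_cost G s \<le> (\<Sum>i\<in>players G. cost G i s))"

text \<open>A default strategy is an element of \<open>'s option\<close>, where \<open>Some\<close> embeds the original
  strategies. Hence \<open>d i\<close> may be one of player \<open>i\<close>'s own strategies, but a new one (\<open>None\<close>) is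
  always available, even if \<open>strategies G i\<close> is the whole type. The function \<open>D\<close> is the extension
  of the social cost to profiles over \<open>insert (d i) (Some ` strategies G i)\<close>.\<close>

definition embed_profile :: "('p, 's) game \<Rightarrow> ('p \<Rightarrow> 's) \<Rightarrow> 'p \<Rightarrow> 's option" where
  "embed_profile G s = (\<lambda>i\<in>players G. Some (s i))"

definition contribution ::
  "('p, 's) game \<Rightarrow> ('p \<Rightarrow> 's option) \<Rightarrow> (('p \<Rightarrow> 's option) \<Rightarrow> real) \<Rightarrow> 'p \<Rightarrow> ('p \<Rightarrow> 's) \<Rightarrow> real" where
  "contribution G d D i s = social_cost G s - D ((embed_profile G s)(i := d i))"

text \<open>\<open>G\<close> is SC-bounded if \<open>SC_bounded_by G d D\<close> holds for some \<open>d\<close> and \<open>D\<close>. The choice is kept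
  explicit because the social contribution game depends on it.\<close>

definition SC_bounded_by ::
  "('p, 's) game \<Rightarrow> ('p \<Rightarrow> 's option) \<Rightarrow> (('p \<Rightarrow> 's option) \<Rightarrow> real) \<Rightarrow> bool" where
  "SC_bounded_by G d D \<longleftrightarrow>
     sum_bounded G \<and>
     (\<forall>s\<in>profiles G. D (embed_profile G s) = social_cost G s) \<and>
     (\<forall>i\<in>players G. \<forall>s\<in>profiles G. cost G i s \<le> contribution G d D i s)"

definition social_contribution_game ::
  "('p, 's) game \<Rightarrow> ('p \<Rightarrow> 's option) \<Rightarrow> (('p \<Rightarrow> 's option) \<Rightarrow> real) \<Rightarrow> ('p, 's) game" where
  "social_contribution_game G d D = G\<lparr>cost := contribution G d D\<rparr>"

definition altruistic_extension :: "('p, 's) game \<Rightarrow> ('p \<Rightarrow> real) \<Rightarrow> ('p, 's) game" where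
  "altruistic_extension G \<alpha> =
     G\<lparr>cost := \<lambda>i s. (1 - \<alpha> i) * cost G i s + \<alpha> i * social_cost G s\<rparr>"

definition optimal_profile :: "('p, 's) game \<Rightarrow> ('p \<Rightarrow> 's) \<Rightarrow> bool" where
  "optimal_profile G s \<longleftrightarrow> s \<in> profiles G \<and> (\<forall>t\<in>profiles G. social_cost G s \<le> social_cost G t)"

definition cost_others :: "('p, 's) game \<Rightarrow> 'p \<Rightarrow> ('p \<Rightarrow> 's) \<Rightarrow> real" where
  "cost_others G i s = social_cost G s - cost G i s"

text \<open>\<open>smooth G \<alpha> l m\<close> says that the \<open>\<alpha>\<close>-altruistic extension of \<open>G\<close> is \<open>(l, m)\<close>-smooth. It takes
  \<open>G\<close> and \<open>\<alpha>\<close> rather than \<open>altruistic_extension G \<alpha>\<close> because the condition refers to the costs of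
  the underlying game, which the altruistic costs do not determine (e.g. if \<open>\<alpha> i = 1\<close>).\<close>

definition smooth :: "('p, 's) game \<Rightarrow> ('p \<Rightarrow> real) \<Rightarrow> real \<Rightarrow> real \<Rightarrow> bool" where
  "smooth G \<alpha> l m \<longleftrightarrow>
     (\<exists>t. optimal_profile G t \<and>
       (\<forall>s\<in>profiles G.
         (\<Sum>i\<in>players G. cost G i (s(i := t i)) +
            \<alpha> i * (cost_others G i (s(i := t i)) - cost_others G i s))
         \<le> l * social_cost G t + m * social_cost G s))"

lemma smooth_iff_altruistic_extension:
  "smooth G \<alpha> l m \<longleftrightarrow>
     (\<exists>t. optimal_profile G t \<and>
       (\<forall>s\<in>profiles G.
         (\<Sum>i\<in>players G. cost G i s + (cost (altruistic_extension G \<alpha>) i (s(i := t i))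
            - cost (altruistic_extension G \<alpha>) i s))
         \<le> l * social_cost G t + m * social_cost G s))"
  by (simp add: smooth_def altruistic_extension_def cost_others_def algebra_simps)

text \<open>The infimum is taken in the extended reals; it is \<open>\<infinity>\<close> if the game is not smooth for any
  parameters with \<open>m < 1\<close>.\<close>

definition robust_poa :: "('p, 's) game \<Rightarrow> ('p \<Rightarrow> real) \<Rightarrow> ereal" where
  "robust_poa G \<alpha> = Inf {ereal (l / (1 - m)) | l m. smooth G \<alpha> l m \<and> m < 1}"

end

theory Submission
  imports Defs
begin

lemma profiles_fun_upd:
  assumes "s \<in> profiles G" "t \<in> profiles G" "i \<in> players G"
  shows "s(i := t i) \<in> profiles G"
  using assms by (auto simp: profiles_def PiE_iff extensional_def)

text \<open>Overwriting entry \<open>i\<close> erases any earlier deviation of \<open>i\<close>, so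
  \<open>contribution\<close> subtracts the same default value at \<open>s\<close> and at
  \<open>s(i := x)\<close>.\<close>

lemma embed_profile_fun_upd:
  assumes "i \<in> players G"
  shows "(embed_profile G (s(i := x)))(i := y) = (embed_profile G s)(i := y)"
  using assms by (auto simp: embed_profile_def fun_eq_iff)

text \<open>The altruistic deviation term is a convex combination of \<open>C\<^sub>i(s')\<close> and
  \<open>C(s') - C(s) + C\<^sub>i(s)\<close>, where \<open>s' = (t\<^sub>i, s\<^sub>-\<^sub>i)\<close>. Since \<open>s\<close> and \<open>s'\<close> agree off \<open>i\<close>,
  the SC-bound at \<open>s'\<close> and at \<open>s\<close>, respectively, bounds each of the two by
  \<open>C(s') - C(\<emptyset>\<^sub>i, s\<^sub>-\<^sub>i)\<close>.\<close>

lemma altruistic_deviation_le_contribution: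
  assumes "SC_bounded_by G d D" "i \<in> players G" "0 \<le> a" "a \<le> 1"
    and "s \<in> profiles G" "s(i := x) \<in> profiles G"
  shows "cost G i (s(i := x)) + a * (cost_others G i (s(i := x)) - cost_others G i s)
    \<le> contribution G d D i (s(i := x))"
proof -
  let ?s' = "s(i := x)"
  have dev: "cost G i ?s' \<le> contribution G d D i ?s'"
    using assms by (simp add: SC_bounded_by_def)
  have "cost G i s \<le> contribution G d D i s"
    using assms by (simp add: SC_bounded_by_def)
  then have alt: "social_cost G ?s' - social_cost G s + cost G i s \<le> contribution G d D i ?s'"
    using assms(2) by (simp add: contribution_def embed_profile_fun_upd)
  have "cost G i ?s' + a * (cost_others G i ?s' - cost_others G i s)
      = (1 - a) * cost G i ?s' + a * (social_cost G ?s' - social_cost G s + cost G i s)"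
    by (simp add: cost_others_def algebra_simps)
  also have "\<dots> \<le> contribution G d D i ?s'"
    using assms(3,4) by (intro convex_bound_le dev alt) auto
  finally show ?thesis .
qed

lemma smooth_altruistic_if_smooth_social_contribution_game:
  assumes sc: "SC_bounded_by G d D"
    and \<alpha>: "\<forall>i\<in>players G. \<alpha> i \<in> {0..1}"
    and smooth: "smooth (social_contribution_game G d D) (\<lambda>_. 0) l m"
  shows "smooth G \<alpha> l m"
proof -
  \<comment> \<open>Only costs differ between the two games, so the same \<open>t\<close> is optimal
    in both; at altruism level 0 the smoothness sum reduces to contributions.\<close>
  from smooth obtain t where opt: "optimal_profile G t"
    and le: "\<And>s. s \<in> profiles G \<Longrightarrow> (\<Sum>i\<in>players G. contribution G d D i (s(i := t i)))
      \<le> l * social_cost G t + m * social_cost G s"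
    by (auto simp: smooth_def social_contribution_game_def optimal_profile_def profiles_def)
  have "(\<Sum>i\<in>players G. cost G i (s(i := t i)) +
      \<alpha> i * (cost_others G i (s(i := t i)) - cost_others G i s))
      \<le> l * social_cost G t + m * social_cost G s" if s: "s \<in> profiles G" for s
  proof -
    have "t \<in> profiles G"
      using opt by (simp add: optimal_profile_def)
    with s \<alpha> show ?thesis
      by (intro order_trans[OF sum_mono le] altruistic_deviation_le_contribution[OF sc])
        (auto intro: profiles_fun_upd)
  qed
  with opt show ?thesis
    unfolding smooth_def by blast
qed

theorem theorem3:
  fixes G :: "('p, 's) game"
    and d :: "'p \<Rightarrow> 's option"
    and D :: "('p \<Rightarrow> 's option) \<Rightarrow> real"
    and \<alpha> :: "'p \<Rightarrow> real"
    and \<xi> :: ereal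
  assumes "finite (players G)"
    and "SC_bounded_by G d D"
    and "robust_poa (social_contribution_game G d D) (\<lambda>_. 0) = \<xi>"
    and "\<forall>i\<in>players G. \<alpha> i \<in> {0..1}"
  shows "robust_poa G \<alpha> \<le> \<xi>"
  unfolding robust_poa_def assms(3)[symmetric]
  \<comment> \<open>Every pair \<open>(l, m)\<close> for the social contribution game also serves
    \<open>G\<close> with \<alpha>, so the infimum for \<open>G\<close> ranges over a
    superset.\<close>
  using smooth_altruistic_if_smooth_social_contribution_game[OF assms(2,4)]
  by (intro Inf_superset_mono) blast

end
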